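(* Let $T_1,\ldots,T_n$ be commuting contractions on a complex Hilbert space $\mathcal{H}$, let $T=\prod_{i=1}^n T_i$, let $\widetilde{\mathcal{K}}$ be the minimal unitary dilation space of $T$ and let $\widetilde{\mathcal{K}_*}$ be the minimal unitary dilation space of $T^*$. Then $(T_1,\ldots,T_n)$ possesses a unitary dilation $(W_1,\ldots,W_n)$ on $\widetilde{\mathcal{K}}$ with $W=\prod_{i=1}^n W_i$ being the minimal unitary dilation of $T$ if and only if $(T_1^*,\ldots,T_n^* )$ possesses a unitary dilation $(Z_1,\ldots,Z_n)$ on $\widetilde{\mathcal{K}_*}$ with $Z=\prod_{i=1}^n Z_i$ being the minimal unitary dilation of $T^*$.
   Context: All operators are bounded linear operators on complex Hilbert spaces; a contraction is an operator of norm at most $1$. Unitary dilation: a commuting tuple of unitaries $(W_1,\ldots,W_n)$ on a Hilbert space $\mathcal{K}'$ is a unitary dilation of a commuting tuple of contractions $(T_1,\ldots,T_n)$ on $\mathcal{H}$ if $\mathcal{H}$ can be realized as a closed linear subspace of $\mathcal{K}'$ and $T_1^{k_1}\cdots T_n^{k_n}=P_{\mathcal{H}}(W_1^{k_1}\cdots W_n^{k_n})|_{\mathcal{H}}$ for all non-negative integers $k_1,\ldots,k_n$, where $P_{\mathcal{H}}:\mathcal{K}'\to\mathcal{H}$ is the orthogonal projection. It is minimal if $\mathcal{K}'=\overline{\mathrm{Span}}\{W_1^{t_1}\cdots W_n^{t_n}h : h\in\mathcal{H},\ t_1,\ldots,t_n\in\mathbb{Z}\}$. For a single contraction $T$ this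 is the case $n=1$; a minimal unitary dilation of $T$ exists and is unique up to unitary equivalence, and the space on which it acts is called the minimal unitary dilation space of $T$. *)

theory Defs
  imports "HOL-Analysis.Analysis"
begin

text \<open>
  A complex Hilbert space is a complete real inner product space whose real inner product is the
  real part of a sesquilinear form \<open>cinner\<close>, linear in the first argument. Norm and topology
  are those of the underlying real space; \<open>Re_cinner\<close> makes the square of the norm of \<open>x\<close>
  equal to \<open>cinner x x\<close>, so positivity and definiteness of \<open>cinner\<close> are inherited.
\<close>

class complex_hilbert = real_inner + complete_space +
  fixes scaleC :: "complex \<Rightarrow> 'a \<Rightarrow> 'a" (infixr "*\<^sub>C" 75)
    and cinner :: "'a \<Rightarrow> 'a \<Rightarrow> complex"
  assumes scaleC_add_right: "c *\<^sub>C (x + y) = c *\<^sub>C x + c *\<^sub>C y"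
    and scaleC_add_left: "(c + d) *\<^sub>C x = c *\<^sub>C x + d *\<^sub>C x"
    and scaleC_scaleC: "c *\<^sub>C (d *\<^sub>C x) = (c * d) *\<^sub>C x"
    and scaleC_of_real: "complex_of_real r *\<^sub>C x = r *\<^sub>R x"
    and cinner_commute: "cinner y x = cnj (cinner x y)"
    and cinner_add_left: "cinner (x + y) z = cinner x z + cinner y z"
    and cinner_scaleC_left: "cinner (c *\<^sub>C x) y = c * cinner x y"
    and Re_cinner: "Re (cinner x y) = x \<bullet> y"

instantiation complex :: complex_hilbert
begin

definition scaleC_complex :: "complex \<Rightarrow> complex \<Rightarrow> complex" where
  "scaleC_complex c x = c * x"

definition cinner_complex :: "complex \<Rightarrow> complex \<Rightarrow> complex" where
  "cinner_complex x y = x * cnj y"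

instance
  by standard
    (auto simp: scaleC_complex_def cinner_complex_def inner_complex_def scaleR_conv_of_real
      algebra_simps)

end

global_interpretation complex_vector: vector_space "scaleC :: complex \<Rightarrow> 'a \<Rightarrow> 'a::complex_hilbert"
  defines cspan = complex_vector.span
proof
  fix x :: 'a
  show "1 *\<^sub>C x = x"
    using scaleC_of_real[of 1 x] by simp
qed (simp_all add: scaleC_add_right scaleC_add_left scaleC_scaleC)

definition bounded_clinear :: "('a::complex_hilbert \<Rightarrow> 'b::complex_hilbert) \<Rightarrow> bool" where
  "bounded_clinear A \<longleftrightarrow> bounded_linear A \<and> (\<forall>c x. A (c *\<^sub>C x) = c *\<^sub>C A x)"

definition contraction :: "('a::complex_hilbert \<Rightarrow> 'a) \<Rightarrow> bool" where
  "contraction A \<longleftrightarrow> bounded_clinear A \<and> onorm A \<le> 1"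

text \<open>
  The constant \<open>adjoint\<close> of the library refers to the real inner product, hence a separate
  definition. For bounded operators the map is determined uniquely.
\<close>

definition cadjoint :: "('a::complex_hilbert \<Rightarrow> 'b::complex_hilbert) \<Rightarrow> 'b \<Rightarrow> 'a" where
  "cadjoint A = (THE B. \<forall>x y. cinner (A x) y = cinner x (B y))"

definition unitary :: "('a::complex_hilbert \<Rightarrow> 'a) \<Rightarrow> bool" where
  "unitary U \<longleftrightarrow> bounded_clinear U \<and> cadjoint U \<circ> U = id \<and> U \<circ> cadjoint U = id"

definition orth_proj :: "'a::complex_hilbert set \<Rightarrow> 'a \<Rightarrow> 'a" where
  "orth_proj M x = (THE y. y \<in> M \<and> (\<forall>z\<in>M. cinner (x - y) z = 0))"

text \<open>
  Tuples of operators are lists. Products are formed in list order, which is immaterial for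
  commuting tuples.
\<close>

definition commuting :: "('a \<Rightarrow> 'a) list \<Rightarrow> bool" where
  "commuting As \<longleftrightarrow> (\<forall>A\<in>set As. \<forall>B\<in>set As. A \<circ> B = B \<circ> A)"

definition op_prod :: "('a \<Rightarrow> 'a) list \<Rightarrow> 'a \<Rightarrow> 'a" where
  "op_prod As = foldr (\<circ>) As id"

definition op_powi :: "('a \<Rightarrow> 'a) \<Rightarrow> int \<Rightarrow> 'a \<Rightarrow> 'a" where
  "op_powi W t = (if 0 \<le> t then W ^^ nat t else inv W ^^ nat (- t))"

text \<open>
  The realization of \<open>H\<close> as a closed linear subspace of \<open>K\<close> is given by a linear isometry
  \<open>J\<close> from \<open>H\<close> to \<open>K\<close>; its range is closed because \<open>H\<close> is complete.
\<close>

definition isometric_embedding :: "('h::complex_hilbert \<Rightarrow> 'k::complex_hilbert) \<Rightarrow> bool" where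
  "isometric_embedding J \<longleftrightarrow> bounded_clinear J \<and> (\<forall>h. norm (J h) = norm h)"

definition unitary_dilation ::
  "('h::complex_hilbert \<Rightarrow> 'k::complex_hilbert) \<Rightarrow> ('h \<Rightarrow> 'h) list \<Rightarrow> ('k \<Rightarrow> 'k) list \<Rightarrow> bool" where
  "unitary_dilation J Ts Ws \<longleftrightarrow>
     isometric_embedding J \<and>
     length Ws = length Ts \<and> commuting Ws \<and> (\<forall>W\<in>set Ws. unitary W) \<and>
     (\<forall>ks :: nat list. length ks = length Ts \<longrightarrow>
        (\<forall>h. J (op_prod (map2 (\<lambda>A k. A ^^ k) Ts ks) h) =
             orth_proj (range J) (op_prod (map2 (\<lambda>A k. A ^^ k) Ws ks) (J h))))"

definition minimal_unitary_dilation ::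
  "('h::complex_hilbert \<Rightarrow> 'k::complex_hilbert) \<Rightarrow> ('h \<Rightarrow> 'h) list \<Rightarrow> ('k \<Rightarrow> 'k) list \<Rightarrow> bool" where
  "minimal_unitary_dilation J Ts Ws \<longleftrightarrow>
     unitary_dilation J Ts Ws \<and>
     closure (cspan {op_prod (map2 op_powi Ws ts) (J h) | h ts. length ts = length Ws}) = UNIV"

end

theory Submission
  imports Defs
begin

text \<open>
  The adjoints of a unitary dilation \<open>(W\<^sub>1, \<dots>, W\<^sub>n)\<close> of \<open>(T\<^sub>1, \<dots>, T\<^sub>n)\<close> dilate the adjoints of
  the \<open>T\<^sub>i\<close>, with the same embedding \<open>J\<close>: the compression identity says that
  \<open>\<langle>T\<^sup>k h, g\<rangle> = \<langle>W\<^sup>k J h, J g\<rangle>\<close> for all vectors \<open>h\<close>, \<open>g\<close>, and this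
  passes to adjoints because the operators commute. If \<open>W = W\<^sub>1 \<cdots> W\<^sub>n\<close> is a minimal dilation of \<open>T\<close>, then the adjoint of \<open>W\<close> is
  a minimal dilation of the adjoint of \<open>T\<close>, because the two-sided orbits of \<open>W\<close> and of its inverse
  coincide. It acts, however, on the dilation space of \<open>T\<close>. The minimal unitary dilation of the
  adjoint of \<open>T\<close> on the other space is unitarily equivalent to it
  (\<open>minimal_unitary_dilation_unique\<close>), and conjugation with the intertwining unitary \<open>\<Phi>\<close> moves the
  adjoints of the \<open>W\<^sub>i\<close> there (\<open>unitary_dilation_transport\<close>). This gives one implication
  (\<open>dilation_of_adjoints\<close>); the other one is the same implication for the adjoint tuple.

  Most of the argument uses only the real inner product \<open>\<bullet>\<close>: for complex linear maps an identity
  between real parts of inner products implies the identity between the inner products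
  themselves. In particular density and continuity arguments can be carried out
  with real spans and closures.
\<close>

section \<open>Adjoints\<close>

text \<open>
  The representing vector minimises \<open>q x = (x \<bullet> x) / 2 - f x\<close>. The parallelogram law makes every
  minimising sequence a Cauchy sequence, and \<open>f y = y \<bullet> z\<close> says that the derivative of \<open>q\<close> at the
  minimum \<open>z\<close> vanishes in the direction \<open>y\<close>.
\<close>

lemma Riesz_representation:
  fixes f :: "'a::{real_inner,complete_space} \<Rightarrow> real"
  assumes "bounded_linear f"
  shows "\<exists>z. \<forall>x. f x = x \<bullet> z"
proof -
  interpret f: bounded_linear f by fact
  define q where "q x = (x \<bullet> x) / 2 - f x" for x
  define m where "m = Inf (range q)"
  obtain K where K: "\<And>x. norm (f x) \<le> norm x * K"
    using f.bounded by blast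
  have "- (K\<^sup>2 / 2) \<le> q x" for x
  proof -
    have "0 \<le> (norm x - K)\<^sup>2" by simp
    moreover have "f x \<le> norm x * K" using K[of x] by simp
    ultimately show ?thesis
      by (simp add: q_def dot_square_norm power2_diff algebra_simps)
  qed
  then have "bdd_below (range q)" by (auto simp: bdd_below_def)
  then have lower: "m \<le> q x" for x
    unfolding m_def by (simp add: cInf_lower)
  have "\<exists>x. q x < m + inverse (real (Suc n))" for n
    using cInf_lessD[of "range q" "m + inverse (real (Suc n))"] by (auto simp: m_def)
  then obtain X where X: "\<And>n. q (X n) < m + inverse (real (Suc n))" by metis
  have parallelogram: "q ((1/2) *\<^sub>R (x + y)) = (q x + q y) / 2 - (norm (x - y))\<^sup>2 / 8" for x y
    unfolding q_def f.scaleR f.add power2_norm_eq_inner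
    by (simp add: inner_add inner_diff inner_commute field_simps)
  have close: "(norm (x - y))\<^sup>2 \<le> 8 * e" if "q x < m + e" "q y < m + e" for x y e
    using parallelogram[of x y] lower[of "(1/2) *\<^sub>R (x + y)"] that by argo
  have "Cauchy X"
  proof (rule metric_CauchyI)
    fix e :: real assume "0 < e"
    then have "0 < e\<^sup>2 / 8" by simp
    then obtain N where N: "inverse (real (Suc N)) < e\<^sup>2 / 8"
      using reals_Archimedean by blast
    have small: "q (X n) < m + inverse (real (Suc N))" if "n \<ge> N" for n
    proof -
      have "inverse (real (Suc n)) \<le> inverse (real (Suc N))"
        using that by (intro le_imp_inverse_le) simp_all
      then show ?thesis using X[of n] by linarith
    qed
    have "dist (X i) (X j) < e" if "i \<ge> N" "j \<ge> N" for i j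
    proof -
      have "(norm (X i - X j))\<^sup>2 < e\<^sup>2"
        using close[OF small[OF that(1)] small[OF that(2)]] N by simp
      then show ?thesis
        using \<open>0 < e\<close> by (simp add: dist_norm power_less_imp_less_base)
    qed
    then show "\<exists>M. \<forall>i\<ge>M. \<forall>j\<ge>M. dist (X i) (X j) < e" by blast
  qed
  then obtain z where z: "X \<longlonglongrightarrow> z"
    using Cauchy_convergent convergent_def by blast
  have "(\<lambda>n. q (X n)) \<longlonglongrightarrow> q z"
    unfolding q_def by (intro tendsto_intros f.tendsto z) simp
  moreover have "(\<lambda>n. m + inverse (real (Suc n))) \<longlonglongrightarrow> m"
    using tendsto_add[OF tendsto_const LIMSEQ_inverse_real_of_nat, of m] by simp
  ultimately have "q z \<le> m"
    using X by (meson LIMSEQ_le less_imp_le)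
  then have min: "q z \<le> q x" for x
    using lower[of x] by simp
  have "f y = y \<bullet> z" for y
  proof (cases "y = 0")
    case False
    define d where "d = y \<bullet> z - f y"
    have pos: "y \<bullet> y > 0" using False by simp
    have "q (z + t *\<^sub>R y) = q z + t * d + t\<^sup>2 * (y \<bullet> y) / 2" for t
      unfolding q_def d_def f.scaleR f.add power2_eq_square
      by (simp add: inner_add inner_commute field_simps)
    \<comment> \<open>the step \<open>t\<close> that minimises this quadratic polynomial\<close>
    from min[of "z + (- d / (y \<bullet> y)) *\<^sub>R y", unfolded this]
    have "d\<^sup>2 \<le> 0" using pos by (simp add: field_simps power2_eq_square)
    then show ?thesis by (simp add: d_def)
  qed (simp add: f.zero)
  then show ?thesis by blast
qed

lemma Im_cinner: "Im (cinner x y) = - ((\<i> *\<^sub>C x) \<bullet> y)"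
  by (simp flip: Re_cinner add: cinner_scaleC_left)

text \<open>
  The imaginary part of an inner product is a real part at \<open>\<i> *\<^sub>C x\<close>, so complex homogeneity
  of both sides recovers it from the real identity.
\<close>

lemma cinner_eqI_real:
  assumes "\<And>x. f x \<bullet> y = g x \<bullet> z" and "\<And>c x. f (c *\<^sub>C x) = c *\<^sub>C f x" and "\<And>c x. g (c *\<^sub>C x) = c *\<^sub>C g x"
  shows "cinner (f x) y = cinner (g x) z"
  using assms(1)[of x] assms(1)[of "\<i> *\<^sub>C x"]
  by (simp add: complex_eq_iff Im_cinner Re_cinner assms(2,3))

lemma cinner_scaleC_right: "cinner x (c *\<^sub>C y) = cnj c * cinner x y"
proof -
  have "cinner x (c *\<^sub>C y) = cnj (cinner (c *\<^sub>C y) x)" by (rule cinner_commute)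
  also have "\<dots> = cnj c * cnj (cinner y x)" unfolding cinner_scaleC_left complex_cnj_mult ..
  also have "cnj (cinner y x) = cinner x y" by (rule cinner_commute[symmetric])
  finally show ?thesis .
qed

lemma inner_scaleC_right: "x \<bullet> (c *\<^sub>C y) = (cnj c *\<^sub>C x) \<bullet> y"
  by (metis Re_cinner cinner_scaleC_left cinner_scaleC_right)

lemma inner_eq_rightI: "(\<And>z. z \<bullet> x = z \<bullet> y) \<Longrightarrow> x = (y :: 'a::real_inner)"
  using vector_eq_ldot[of x y] by blast

lemma bounded_clinearD:
  assumes "bounded_clinear A"
  shows "bounded_linear A" "A (c *\<^sub>C x) = c *\<^sub>C A x"
  using assms by (auto simp: bounded_clinear_def)

lemma cadjoint_exists:
  fixes A :: "'a::complex_hilbert \<Rightarrow> 'b::complex_hilbert"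
  assumes "bounded_clinear A"
  obtains B where "\<And>x y. cinner (A x) y = cinner x (B y)"
proof -
  have "\<exists>z. \<forall>x. A x \<bullet> y = x \<bullet> z" for y
    using Riesz_representation[of "\<lambda>x. A x \<bullet> y"]
      bounded_linear_compose[OF bounded_linear_inner_left bounded_clinearD(1)[OF assms]] by simp
  then obtain B where "\<And>x y. A x \<bullet> y = x \<bullet> B y" by metis
  then have "cinner (A x) y = cinner x (B y)" for x y
    using cinner_eqI_real[of A y "\<lambda>x. x" "B y"] bounded_clinearD(2)[OF assms] by simp
  then show thesis by (rule that)
qed

lemma cadjoint_eqI:
  assumes "\<And>x y. A x \<bullet> y = x \<bullet> B y" and "\<And>c x. A (c *\<^sub>C x) = c *\<^sub>C A x"
  shows "cadjoint A = B"
proof -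
  have "cinner (A x) y = cinner x (B y)" for x y
    using cinner_eqI_real[of A y "\<lambda>x. x" "B y"] assms by simp
  moreover have "C = B" if "\<forall>x y. cinner (A x) y = cinner x (C y)" for C
  proof
    fix y
    show "C y = B y"
      by (rule inner_eq_rightI) (metis Re_cinner that assms(1))
  qed
  ultimately show ?thesis
    unfolding cadjoint_def by (intro the_equality) auto
qed

lemma inner_cadjoint:
  assumes "bounded_clinear A"
  shows "A x \<bullet> y = x \<bullet> cadjoint A y"
proof -
  obtain B where "\<And>x y. cinner (A x) y = cinner x (B y)"
    using cadjoint_exists[OF assms] by blast
  then have B: "\<And>x y. A x \<bullet> y = x \<bullet> B y" by (metis Re_cinner)
  then have "cadjoint A = B"
    using bounded_clinearD(2)[OF assms] by (intro cadjoint_eqI)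
  with B show ?thesis by simp
qed

text \<open>
  Boundedness comes from the Cauchy--Schwarz inequality for
  \<open>norm (cadjoint A y) ^ 2 = A (cadjoint A y) \<bullet> y\<close>.
\<close>

lemma bounded_clinear_cadjoint:
  assumes "bounded_clinear A"
  shows "bounded_clinear (cadjoint A)"
proof -
  note adj = inner_cadjoint[OF assms, symmetric]
  interpret A: bounded_linear A using assms by (rule bounded_clinearD)
  obtain K where K: "\<And>x. norm (A x) \<le> norm x * K" "K \<ge> 0"
    using A.nonneg_bounded by blast
  have add: "cadjoint A (x + y) = cadjoint A x + cadjoint A y" for x y
    by (rule inner_eq_rightI) (simp add: inner_add_right adj)
  have scale: "cadjoint A (c *\<^sub>C x) = c *\<^sub>C cadjoint A x" for c x
  proof (rule inner_eq_rightI)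
    fix z
    show "z \<bullet> cadjoint A (c *\<^sub>C x) = z \<bullet> (c *\<^sub>C cadjoint A x)"
      by (simp add: adj inner_scaleC_right bounded_clinearD(2)[OF assms])
  qed
  have "norm (cadjoint A y) \<le> norm y * K" for y
  proof (cases "cadjoint A y = 0")
    case False
    have "norm (cadjoint A y) * norm (cadjoint A y) = A (cadjoint A y) \<bullet> y"
      by (simp add: inner_cadjoint[OF assms] flip: power2_norm_eq_inner power2_eq_square)
    also have "\<dots> \<le> norm (A (cadjoint A y)) * norm y" by (rule norm_cauchy_schwarz)
    also have "\<dots> \<le> norm (cadjoint A y) * (norm y * K)"
      using mult_right_mono[OF K(1)[of "cadjoint A y"], of "norm y"] by (simp add: ac_simps)
    finally show ?thesis using False by simp
  qed (simp add: K)
  moreover have "cadjoint A (r *\<^sub>R x) = r *\<^sub>R cadjoint A x" for r x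
    using scale[of "complex_of_real r"] by (simp add: scaleC_of_real)
  ultimately have "bounded_linear (cadjoint A)"
    using add by (intro bounded_linear_intro[where K = K]) auto
  with scale show ?thesis by (simp add: bounded_clinear_def)
qed

lemma cadjoint_cadjoint:
  assumes "bounded_clinear A"
  shows "cadjoint (cadjoint A) = A"
  using inner_cadjoint[OF assms] bounded_clinearD(2)[OF bounded_clinear_cadjoint[OF assms]]
  by (intro cadjoint_eqI) (auto simp: inner_commute)

lemma bounded_clinear_id: "bounded_clinear id"
  by (simp add: bounded_clinear_def id_def)

lemma bounded_clinear_comp:
  "bounded_clinear A \<Longrightarrow> bounded_clinear B \<Longrightarrow> bounded_clinear (A \<circ> B)"
  by (auto simp: bounded_clinear_def o_def intro: bounded_linear_compose)

lemma cadjoint_id: "cadjoint (id :: 'a::complex_hilbert \<Rightarrow> 'a) = id"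
  by (rule cadjoint_eqI) auto

lemma cadjoint_comp:
  assumes "bounded_clinear A" "bounded_clinear B"
  shows "cadjoint (A \<circ> B) = cadjoint B \<circ> cadjoint A"
  by (rule cadjoint_eqI) (simp_all add: inner_cadjoint assms bounded_clinearD(2))

section \<open>Isometries and unitary operators\<close>

lemma isometric_embedding_iff:
  "isometric_embedding J \<longleftrightarrow> bounded_clinear J \<and> (\<forall>x y. J x \<bullet> J y = x \<bullet> y)"
proof
  assume J: "isometric_embedding J"
  then interpret J: bounded_linear J
    by (auto simp: isometric_embedding_def bounded_clinear_def)
  show "bounded_clinear J \<and> (\<forall>x y. J x \<bullet> J y = x \<bullet> y)"
    using J by (auto simp: isometric_embedding_def dot_norm simp flip: J.add)
qed (auto simp: isometric_embedding_def norm_eq_sqrt_inner)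

lemma cadjoint_isometry:
  assumes "isometric_embedding J"
  shows "cadjoint J (J x) = x"
proof (rule inner_eq_rightI)
  fix z
  have J: "bounded_clinear J" "\<And>x y. J x \<bullet> J y = x \<bullet> y"
    using assms by (auto simp: isometric_embedding_iff)
  show "z \<bullet> cadjoint J (J x) = z \<bullet> x"
    by (simp add: J(2) flip: inner_cadjoint[OF J(1)])
qed

lemma cadjoint_surj_isometry:
  assumes "isometric_embedding J" "surj J"
  shows "J (cadjoint J y) = y"
  by (metis assms cadjoint_isometry surjD)

lemma unitary_iff: "unitary U \<longleftrightarrow> isometric_embedding U \<and> surj U"
proof (intro iffI conjI)
  assume U: "unitary U"
  then have bounded: "bounded_clinear U" by (simp add: unitary_def)
  have inv: "cadjoint U (U x) = x" "U (cadjoint U x) = x" for x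
    using U by (simp_all add: unitary_def pointfree_idE)
  show "isometric_embedding U"
    by (simp add: isometric_embedding_iff bounded inner_cadjoint[OF bounded] inv)
  show "surj U" by (rule surjI) (rule inv)
next
  assume "isometric_embedding U \<and> surj U"
  then show "unitary U"
    by (simp add: unitary_def fun_eq_iff cadjoint_isometry cadjoint_surj_isometry
        isometric_embedding_iff[THEN iffD1])
qed

lemma unitaryD:
  assumes "unitary U"
  shows "bounded_clinear U" "U x \<bullet> U y = x \<bullet> y" "bij U" "inv U = cadjoint U"
proof -
  have inv: "cadjoint U \<circ> U = id" "U \<circ> cadjoint U = id"
    using assms by (simp_all add: unitary_def)
  from inv show "bij U" using o_bij by blast
  from inv show "inv U = cadjoint U" by (rule inv_unique_comp[rotated])
  show "bounded_clinear U" "U x \<bullet> U y = x \<bullet> y"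
    using assms unitary_iff isometric_embedding_iff by blast+
qed

lemma unitary_cadjoint:
  assumes "unitary U"
  shows "unitary (cadjoint U)"
  using assms by (auto simp: unitary_def cadjoint_cadjoint bounded_clinear_cadjoint)

lemma inner_unitary_funpow: "unitary U \<Longrightarrow> (U ^^ n) x \<bullet> (U ^^ n) y = x \<bullet> y"
  by (induction n) (simp_all add: unitaryD(2))

section \<open>Products and powers of commuting operators\<close>

lemma op_prod_simps: "op_prod [] = id" "op_prod (A # As) = A \<circ> op_prod As"
  by (simp_all add: op_prod_def)

lemma bounded_clinear_op_prod:
  "(\<And>A. A \<in> set As \<Longrightarrow> bounded_clinear A) \<Longrightarrow> bounded_clinear (op_prod As)"
  by (induction As) (simp_all add: op_prod_simps bounded_clinear_id bounded_clinear_comp)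

lemma op_prod_commute:
  "(\<And>B. B \<in> set Bs \<Longrightarrow> A \<circ> B = B \<circ> A) \<Longrightarrow> A \<circ> op_prod Bs = op_prod Bs \<circ> A"
  by (induction Bs) (simp_all add: op_prod_simps fun_eq_iff)

lemma commuting_map_cadjoint:
  assumes "commuting As" and "\<And>A. A \<in> set As \<Longrightarrow> bounded_clinear A"
  shows "commuting (map cadjoint As)"
  using assms by (auto simp: commuting_def simp flip: cadjoint_comp)

text \<open>
  Taking adjoints reverses the order of the factors; commutativity restores it.
\<close>

lemma cadjoint_op_prod:
  assumes "commuting As" and "\<And>A. A \<in> set As \<Longrightarrow> bounded_clinear A"
  shows "cadjoint (op_prod As) = op_prod (map cadjoint As)"
  using assms
proof (induction As)
  case Nil
  then show ?case by (simp add: op_prod_simps cadjoint_id del: id_apply)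
next
  case (Cons A As)
  have bounded: "bounded_clinear A" "bounded_clinear (op_prod As)"
    using Cons.prems(2) by (auto intro: bounded_clinear_op_prod)
  have commuting: "commuting As" "\<And>B. B \<in> set As \<Longrightarrow> A \<circ> B = B \<circ> A"
    using Cons.prems(1) unfolding commuting_def by (meson list.set_intros)+
  have "A \<circ> op_prod As = op_prod As \<circ> A"
    by (rule op_prod_commute) (rule commuting(2))
  then have "cadjoint (op_prod (A # As)) = cadjoint (op_prod As \<circ> A)"
    by (simp add: op_prod_simps)
  also have "\<dots> = cadjoint A \<circ> cadjoint (op_prod As)"
    by (rule cadjoint_comp[OF bounded(2,1)])
  also have "cadjoint (op_prod As) = op_prod (map cadjoint As)"
    using Cons.IH[OF commuting(1)] Cons.prems(2) by simp
  finally show ?case by (simp add: op_prod_simps)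
qed

lemma bounded_clinear_funpow:
  fixes A :: "'a::complex_hilbert \<Rightarrow> 'a"
  shows "bounded_clinear A \<Longrightarrow> bounded_clinear (A ^^ n)"
  by (induction n) (simp_all add: bounded_clinear_id bounded_clinear_comp)

lemma cadjoint_funpow:
  fixes A :: "'a::complex_hilbert \<Rightarrow> 'a"
  assumes "bounded_clinear A"
  shows "cadjoint (A ^^ n) = cadjoint A ^^ n"
proof (induction n)
  case (Suc n)
  have "cadjoint (A ^^ Suc n) = cadjoint (A ^^ n) \<circ> cadjoint A"
    unfolding funpow.simps by (rule cadjoint_comp[OF assms bounded_clinear_funpow[OF assms]])
  with Suc show ?case by (simp only: funpow_Suc_right)
qed (simp only: funpow.simps cadjoint_id)

lemma funpow_commute_funpow:
  fixes A B :: "'a \<Rightarrow> 'a"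
  assumes "A \<circ> B = B \<circ> A"
  shows "A ^^ m \<circ> B ^^ n = B ^^ n \<circ> A ^^ m"
proof -
  have *: "A \<circ> B ^^ n = B ^^ n \<circ> A" if "A \<circ> B = B \<circ> A" for A B :: "'a \<Rightarrow> 'a" and n
    using that by (induction n) (simp_all add: fun_eq_iff)
  show ?thesis using *[OF *[OF assms, symmetric], symmetric] by simp
qed

lemma mem_set_map2D:
  assumes "C \<in> set (map2 f As ks)"
  shows "\<exists>A\<in>set As. \<exists>k. C = f A k"
proof -
  obtain A k where "(A, k) \<in> set (zip As ks)" "C = f A k"
    using assms by auto
  with set_zip_leftD[OF this(1)] show ?thesis by blast
qed

lemma cadjoint_op_prod_funpow:
  fixes As :: "('a::complex_hilbert \<Rightarrow> 'a) list"
  assumes "commuting As" and "\<And>A. A \<in> set As \<Longrightarrow> bounded_clinear A"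
  shows "cadjoint (op_prod (map2 (\<lambda>A k. A ^^ k) As ks))
    = op_prod (map2 (\<lambda>A k. A ^^ k) (map cadjoint As) ks)"
proof -
  let ?Ps = "map2 (\<lambda>A k. A ^^ k) As ks"
  have "commuting ?Ps"
    unfolding commuting_def
  proof (intro ballI)
    fix C D assume "C \<in> set ?Ps" "D \<in> set ?Ps"
    obtain A m where "A \<in> set As" "C = A ^^ m"
      using mem_set_map2D[OF \<open>C \<in> set ?Ps\<close>] by blast
    moreover obtain B n where "B \<in> set As" "D = B ^^ n"
      using mem_set_map2D[OF \<open>D \<in> set ?Ps\<close>] by blast
    ultimately show "C \<circ> D = D \<circ> C"
      using assms(1) funpow_commute_funpow[of A B m n] unfolding commuting_def by blast
  qed
  moreover have "bounded_clinear C" if "C \<in> set ?Ps" for C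
    using mem_set_map2D[OF that] assms(2) bounded_clinear_funpow by blast
  ultimately have "cadjoint (op_prod ?Ps) = op_prod (map cadjoint ?Ps)"
    by (rule cadjoint_op_prod)
  also have "map cadjoint ?Ps = map2 (\<lambda>A k. A ^^ k) (map cadjoint As) ks"
    using assms(2) by (auto simp: zip_map1 cadjoint_funpow dest: set_zip_leftD)
  finally show ?thesis .
qed

lemma bounded_clinear_op_prod_funpow:
  "(\<And>A. A \<in> set As \<Longrightarrow> bounded_clinear A) \<Longrightarrow>
    bounded_clinear (op_prod (map2 (\<lambda>A k. A ^^ k) As ks))"
  by (rule bounded_clinear_op_prod) (metis mem_set_map2D bounded_clinear_funpow)

text \<open>
  For negative \<open>t\<close> this cancels one factor \<open>inv W\<close>; together with \<open>funpow_op_powi\<close> it is the part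
  of the law of exponents that shifts integer exponents to natural ones.
\<close>

lemma op_powi_Suc:
  assumes "bij W"
  shows "W (op_powi W t x) = op_powi W (t + 1) x"
proof (cases "0 \<le> t")
  case True
  then show ?thesis by (simp add: op_powi_def nat_add_distrib)
next
  case False
  then have "nat (- t) = Suc (nat (- (t + 1)))" by simp
  then have "W (op_powi W t x) = (inv W ^^ nat (- (t + 1))) x"
    using False assms by (simp add: op_powi_def bij_inv_eq_iff[symmetric] bij_is_surj surj_f_inv_f)
  also have "\<dots> = op_powi W (t + 1) x"
    using False by (cases "t = - 1") (auto simp: op_powi_def)
  finally show ?thesis .
qed

lemma funpow_op_powi: "bij W \<Longrightarrow> (W ^^ n) (op_powi W t x) = op_powi W (int n + t) x"
  by (induction n) (simp_all add: op_powi_Suc ac_simps)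

lemma op_powi_cadjoint:
  assumes "unitary W"
  shows "op_powi (cadjoint W) t = op_powi W (- t)"
  using unitaryD(4)[OF assms] unitaryD(4)[OF unitary_cadjoint[OF assms]]
    cadjoint_cadjoint[OF unitaryD(1)[OF assms]]
  by (auto simp: op_powi_def)

section \<open>The compression identity as an identity of inner products\<close>

text \<open>
  Orthogonality of the remainder \<open>u\<close> to the range of \<open>J\<close> is first shown for \<open>\<bullet>\<close> and extends to
  \<open>cinner\<close> because the range is a complex subspace.
\<close>

lemma orth_proj_range:
  assumes "isometric_embedding J"
  shows "orth_proj (range J) x = J (cadjoint J x)"
proof -
  have J: "bounded_clinear J" "\<And>x y. J x \<bullet> J y = x \<bullet> y"
    using assms by (auto simp: isometric_embedding_iff)
  have adj: "J h \<bullet> x = h \<bullet> cadjoint J x" for h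
    by (rule inner_cadjoint[OF J(1)])
  define u where "u = x - J (cadjoint J x)"
  have orth: "u \<bullet> J h = 0" for h
  proof -
    have "x \<bullet> J h = cadjoint J x \<bullet> h" using adj[of h] by (simp add: inner_commute)
    then show ?thesis by (simp add: u_def inner_diff_left J(2))
  qed
  have "cinner u (J h) = 0" for h
  proof -
    have "(\<i> *\<^sub>C u) \<bullet> J h = u \<bullet> J (cnj \<i> *\<^sub>C h)"
      unfolding bounded_clinearD(2)[OF J(1)] inner_scaleC_right complex_cnj_cnj ..
    then show ?thesis
      by (simp only: complex_eq_iff Re_cinner Im_cinner orth) simp
  qed
  moreover have "J g = J (cadjoint J x)" if "\<forall>z\<in>range J. cinner (x - J g) z = 0" for g
  proof -
    have "J h \<bullet> (x - J g) = 0" for h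
      using that Re_cinner[of "x - J g" "J h"] by (simp add: inner_commute)
    then have "h \<bullet> g = h \<bullet> cadjoint J x" for h
      by (simp add: inner_diff_right J(2) adj)
    then show ?thesis using inner_eq_rightI by blast
  qed
  ultimately show ?thesis
    unfolding orth_proj_def u_def by (intro the_equality) auto
qed

text \<open>
  In the dilation identity this replaces the projection by inner products with the vectors \<open>J g\<close>,
  which are easy to dualise and to move along isometries.
\<close>

lemma compression_iff:
  assumes "isometric_embedding J"
  shows "J a = orth_proj (range J) b \<longleftrightarrow> (\<forall>g. a \<bullet> g = b \<bullet> J g)"
proof -
  have J: "bounded_clinear J" "\<And>x y. J x \<bullet> J y = x \<bullet> y"
    using assms by (auto simp: isometric_embedding_iff)
  have "J a = orth_proj (range J) b \<longleftrightarrow> a = cadjoint J b"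
    unfolding orth_proj_range[OF assms]
    by (metis J(2) inner_eq_rightI)
  also have "\<dots> \<longleftrightarrow> (\<forall>g. a \<bullet> g = cadjoint J b \<bullet> g)"
    by (metis inner_commute inner_eq_rightI)
  also have "(\<lambda>g. cadjoint J b \<bullet> g) = (\<lambda>g. b \<bullet> J g)"
    using inner_cadjoint[OF J(1), of _ b] by (simp add: inner_commute)
  then have "(\<forall>g. a \<bullet> g = cadjoint J b \<bullet> g) \<longleftrightarrow> (\<forall>g. a \<bullet> g = b \<bullet> J g)"
    by (simp add: fun_eq_iff)
  finally show ?thesis .
qed

lemma unitary_dilation_iff:
  "unitary_dilation J Ts Ws \<longleftrightarrow>
     isometric_embedding J \<and> length Ws = length Ts \<and> commuting Ws \<and> (\<forall>W\<in>set Ws. unitary W) \<and>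
     (\<forall>ks h g. length ks = length Ts \<longrightarrow>
        op_prod (map2 (\<lambda>A k. A ^^ k) Ts ks) h \<bullet> g =
        op_prod (map2 (\<lambda>A k. A ^^ k) Ws ks) (J h) \<bullet> J g)"
  unfolding unitary_dilation_def using compression_iff[of J] by fast

lemma unitary_dilation_single_iff:
  "unitary_dilation J [S] [U] \<longleftrightarrow>
     isometric_embedding J \<and> unitary U \<and> (\<forall>n h g. (S ^^ n) h \<bullet> g = (U ^^ n) (J h) \<bullet> J g)"
proof -
  have "(\<forall>ks. length ks = length [S] \<longrightarrow> P ks) \<longleftrightarrow> (\<forall>n. P [n])" for P :: "nat list \<Rightarrow> bool"
    by (auto simp: length_Suc_conv)
  then show ?thesis
    unfolding unitary_dilation_iff by (auto simp: op_prod_simps commuting_def length_Suc_conv)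
qed

section \<open>Adjoints of dilations\<close>

lemma unitary_dilation_cadjoint:
  assumes dil: "unitary_dilation J Ts Ws"
    and Ts: "commuting Ts" "\<And>A. A \<in> set Ts \<Longrightarrow> bounded_clinear A"
  shows "unitary_dilation J (map cadjoint Ts) (map cadjoint Ws)"
proof -
  note dil = dil[unfolded unitary_dilation_iff]
  have Ws: "commuting Ws" "\<And>W. W \<in> set Ws \<Longrightarrow> bounded_clinear W"
    using dil by (auto simp: unitaryD(1))
  show ?thesis
    unfolding unitary_dilation_iff
  proof (intro conjI allI impI)
    show "isometric_embedding J" "length (map cadjoint Ws) = length (map cadjoint Ts)"
      using dil by simp_all
    show "commuting (map cadjoint Ws)" by (rule commuting_map_cadjoint[OF Ws])
    show "\<forall>W\<in>set (map cadjoint Ws). unitary W"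
      using dil by (auto intro: unitary_cadjoint)
    fix ks :: "nat list" and h g
    assume len: "length ks = length (map cadjoint Ts)"
    let ?P = "\<lambda>As. op_prod (map2 (\<lambda>A k. A ^^ k) As ks)"
    have "?P (map cadjoint Ts) h \<bullet> g = ?P Ts g \<bullet> h"
      using cadjoint_op_prod_funpow[OF Ts, of ks]
        inner_cadjoint[OF bounded_clinear_op_prod_funpow[OF Ts(2)], of Ts ks g h]
      by (simp add: inner_commute)
    also have "\<dots> = ?P Ws (J g) \<bullet> J h"
      using dil len by simp
    also have "\<dots> = ?P (map cadjoint Ws) (J h) \<bullet> J g"
      using cadjoint_op_prod_funpow[OF Ws, of ks]
        inner_cadjoint[OF bounded_clinear_op_prod_funpow[OF Ws(2)], of Ws ks "J g" "J h"]
      by (simp add: inner_commute)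
    finally show "?P (map cadjoint Ts) h \<bullet> g = ?P (map cadjoint Ws) (J h) \<bullet> J g" .
  qed
qed

text \<open>
  The orbit that spans the dilation space is the same for \<open>Ws\<close> and for the inverses, up to the
  sign of the exponents.
\<close>

lemma minimal_unitary_dilation_cadjoint:
  assumes dil: "minimal_unitary_dilation J Ts Ws"
    and Ts: "commuting Ts" "\<And>A. A \<in> set Ts \<Longrightarrow> bounded_clinear A"
  shows "minimal_unitary_dilation J (map cadjoint Ts) (map cadjoint Ws)"
proof -
  have unitary: "\<forall>W\<in>set Ws. unitary W"
    using dil by (simp add: minimal_unitary_dilation_def unitary_dilation_def)
  have powi: "map2 op_powi (map cadjoint Ws) ts = map2 op_powi Ws (map uminus ts)" for ts
    using unitary by (auto simp: zip_map1 zip_map2 op_powi_cadjoint dest: set_zip_leftD)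
  have "op_prod (map2 op_powi Ws ts) (J h) \<in>
      {op_prod (map2 op_powi (map cadjoint Ws) us) (J h) | h us. length us = length (map cadjoint Ws)}"
    if "length ts = length Ws" for ts h
    unfolding powi using that
    by (intro CollectI exI[of _ h] exI[of _ "map uminus ts"]) (simp add: o_def)
  moreover have "op_prod (map2 op_powi (map cadjoint Ws) ts) (J h) \<in>
      {op_prod (map2 op_powi Ws us) (J h) | h us. length us = length Ws}"
    if "length ts = length Ws" for ts h
    unfolding powi using that
    by (intro CollectI exI[of _ h] exI[of _ "map uminus ts"]) simp
  ultimately have
    "{op_prod (map2 op_powi (map cadjoint Ws) us) (J h) | h us. length us = length (map cadjoint Ws)}
      = {op_prod (map2 op_powi Ws us) (J h) | h us. length us = length Ws}"
    by auto
  then show ?thesis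
    using dil unitary_dilation_cadjoint[OF _ Ts, of J Ws]
    unfolding minimal_unitary_dilation_def by simp
qed

section \<open>Uniqueness of the minimal unitary dilation\<close>

lemma subspace_closure:
  fixes S :: "'a::real_normed_vector set"
  assumes "subspace S"
  shows "subspace (closure S)"
proof (rule subspaceI)
  show "0 \<in> closure S"
    using assms closure_subset subspace_0 by blast
next
  fix x y assume "x \<in> closure S" "y \<in> closure S"
  then obtain a b where "\<And>n. a n \<in> S" "a \<longlonglongrightarrow> x" "\<And>n. b n \<in> S" "b \<longlonglongrightarrow> y"
    unfolding closure_sequential by blast
  then show "x + y \<in> closure S"
    using assms unfolding closure_sequential
    by (intro exI[of _ "\<lambda>n. a n + b n"]) (simp add: subspace_add tendsto_add)
next
  fix c x assume "x \<in> closure S"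
  then obtain a where "\<And>n. a n \<in> S" "a \<longlonglongrightarrow> x"
    unfolding closure_sequential by blast
  then show "c *\<^sub>R x \<in> closure S"
    using assms unfolding closure_sequential
    by (intro exI[of _ "\<lambda>n. c *\<^sub>R a n"]) (simp add: subspace_scale tendsto_scaleR)
qed

lemma bounded_linear_eq_on_closure_span:
  assumes "bounded_linear a" "bounded_linear b"
    and "\<And>x. x \<in> S \<Longrightarrow> a x = b x" and "x \<in> closure (span S)"
  shows "a x = b x"
proof -
  interpret d: bounded_linear "\<lambda>x. a x - b x"
    using assms(1,2) by (rule bounded_linear_sub)
  have "span S \<subseteq> {x. a x - b x = 0}"
    using assms(3) d.linear_axioms by (intro span_minimal linear_subspace_kernel) auto
  moreover have "closed {x. a x - b x = 0}"
    by (intro closed_Collect_eq d.continuous_on continuous_on_id continuous_on_const)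
  ultimately have "closure (span S) \<subseteq> {x. a x - b x = 0}"
    by (rule closure_minimal)
  with assms(4) show ?thesis by auto
qed

text \<open>
  The isometry is constructed through its graph \<open>R\<close>, the closed linear span of the pairs
  \<open>(f i, g i)\<close>. Equality of the Gram matrices extends to \<open>R\<close> by linearity and continuity, so that
  both components of an element of \<open>R\<close> have the same norm. Hence \<open>R\<close> is the graph of an
  isometry, and both projections of \<open>R\<close> are complete, thus closed, and by density everything.
\<close>

lemma isometry_of_dense_families:
  fixes f :: "'i \<Rightarrow> 'a::{real_inner,complete_space}" and g :: "'i \<Rightarrow> 'b::{real_inner,complete_space}"
  assumes gram: "\<And>i j. f i \<bullet> f j = g i \<bullet> g j"
    and dense_f: "closure (span (range f)) = UNIV"
    and dense_g: "closure (span (range g)) = UNIV"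
  obtains \<Phi> where "bounded_linear \<Phi>" "\<And>x y. \<Phi> x \<bullet> \<Phi> y = x \<bullet> y" "surj \<Phi>" "\<And>i. \<Phi> (f i) = g i"
proof -
  define R where "R = closure (span (range (\<lambda>i. (f i, g i))))"
  have generators: "(f i, g i) \<in> R" for i
    unfolding R_def by (meson closure_subset rangeI span_base subsetD)
  have subspace: "subspace R"
    unfolding R_def by (intro subspace_closure subspace_span)
  have bl: "bounded_linear (\<lambda>p. fst p \<bullet> x)" "bounded_linear (\<lambda>p. snd p \<bullet> y)"
    for x :: 'a and y :: 'b
    by (intro bounded_linear_compose[OF bounded_linear_inner_left]
        bounded_linear_fst bounded_linear_snd)+
  have "fst p \<bullet> f i = snd p \<bullet> g i" if "p \<in> R" for p i
    using bounded_linear_eq_on_closure_span[OF bl _ that[unfolded R_def], of "f i" "g i"] gram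
    by fastforce
  then have "f i \<bullet> fst q = g i \<bullet> snd q" if "q \<in> R" for q i
    using that by (simp add: inner_commute)
  then have inner: "fst p \<bullet> fst q = snd p \<bullet> snd q" if "p \<in> R" "q \<in> R" for p q
    using bounded_linear_eq_on_closure_span[OF bl _ that(1)[unfolded R_def], of "fst q" "snd q"] that(2)
    by fastforce
  then have norm: "norm (fst p) = norm (snd p)" if "p \<in> R" for p
    using that by (simp add: norm_eq_sqrt_inner)
  have "complete R"
    by (simp add: R_def complete_eq_closed)
  have total: "c ` R = UNIV"
    if "bounded_linear c" "\<And>p. p \<in> R \<Longrightarrow> norm p \<le> 2 * norm (c p)"
      and "\<And>i. e i \<in> c ` R" and "closure (span (range e)) = UNIV"
    for c :: "'a \<times> 'b \<Rightarrow> 'c::{real_inner,complete_space}" and e :: "'i \<Rightarrow> 'c"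
  proof -
    have "complete (c ` R)"
      using complete_isometric_image[of "1/2" R c] that(1,2) subspace \<open>complete R\<close> by fastforce
    then have "closed (c ` R)" by (simp add: complete_eq_closed)
    moreover have "span (range e) \<subseteq> c ` R"
      using that(1,3) subspace
      by (intro span_minimal linear_subspace_image) (auto simp: bounded_linear.linear)
    ultimately show ?thesis
      using closure_minimal[of "span (range e)" "c ` R"] that(4) by auto
  qed
  have "norm p \<le> norm (fst p) + norm (snd p)" for p :: "'a \<times> 'b"
    using norm_Pair_le[of "fst p" "snd p"] by simp
  then have bound: "norm p \<le> 2 * norm (fst p)" "norm p \<le> 2 * norm (snd p)" if "p \<in> R" for p
    using norm[OF that] by (metis mult_2)+
  have "fst ` R = UNIV"
  proof (rule total[OF bounded_linear_fst bound(1) _ dense_f])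
    show "f i \<in> fst ` R" for i by (rule image_eqI[OF _ generators]) simp
  qed
  then have "\<forall>x. \<exists>y. (x, y) \<in> R" by (metis UNIV_I imageE prod.collapse)
  then obtain \<Phi> where \<Phi>: "\<And>x. (x, \<Phi> x) \<in> R" by metis
  have graph: "\<Phi> x = y" if "(x, y) \<in> R" for x y
    using norm[OF subspace_diff[OF subspace \<Phi>[of x] that]] by simp
  have isometry: "\<Phi> x \<bullet> \<Phi> y = x \<bullet> y" for x y
    using inner[OF \<Phi>[of x] \<Phi>[of y]] by simp
  have "snd ` R = UNIV"
  proof (rule total[OF bounded_linear_snd bound(2) _ dense_g])
    show "g i \<in> snd ` R" for i by (rule image_eqI[OF _ generators]) simp
  qed
  then have "surj \<Phi>"
    by (metis UNIV_I imageE graph prod.collapse surj_def)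
  moreover have "bounded_linear \<Phi>"
  proof (rule bounded_linear_intro[where K = 1])
    show "\<Phi> (x + y) = \<Phi> x + \<Phi> y" for x y
      using subspace_add[OF subspace \<Phi>[of x] \<Phi>[of y]] by (simp add: graph)
    show "\<Phi> (r *\<^sub>R x) = r *\<^sub>R \<Phi> x" for r x
      using subspace_scale[OF subspace \<Phi>[of x]] by (simp add: graph)
    show "norm (\<Phi> x) \<le> norm x * 1" for x
      by (simp add: norm_eq_sqrt_inner isometry)
  qed
  ultimately show thesis
    using that isometry graph generators by blast
qed

lemma bounded_linear_scaleC: "bounded_linear (\<lambda>x :: 'a::complex_hilbert. c *\<^sub>C x)"
proof (rule bounded_linear_intro[where K = "cmod c"])
  fix x :: 'a
  have "(c *\<^sub>C x) \<bullet> (c *\<^sub>C x) = (complex_of_real ((cmod c)\<^sup>2) *\<^sub>C x) \<bullet> x"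
    unfolding inner_scaleC_right scaleC_scaleC complex_norm_square by (simp add: mult.commute)
  also have "\<dots> = (norm x * cmod c)\<^sup>2"
    unfolding scaleC_of_real by (simp add: power_mult_distrib dot_square_norm)
  finally show "norm (c *\<^sub>C x) \<le> norm x * cmod c"
    by (simp add: norm_eq_sqrt_inner[of "c *\<^sub>C x"])
next
  show "c *\<^sub>C (r *\<^sub>R x) = r *\<^sub>R (c *\<^sub>C x)" for r and x :: 'a
    by (simp add: scaleC_scaleC mult.commute flip: scaleC_of_real)
qed (rule scaleC_add_right)

text \<open>
  The orbit of the embedded space under a unitary is invariant under complex scalars, so
  minimality can be expressed with the real span and \<open>isometry_of_dense_families\<close> applies.
\<close>

lemma cspan_eq_span:
  assumes "\<And>c x. x \<in> S \<Longrightarrow> c *\<^sub>C x \<in> S"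
  shows "cspan S = span S"
proof
  have scale: "c *\<^sub>C x \<in> span S" if "x \<in> span S" for c x
    using that
  proof (induction rule: span_induct_alt)
    case base
    show ?case using complex_vector.scale_zero_right[of c] by (simp add: span_zero)
  next
    case (step r x y)
    have "c *\<^sub>C (r *\<^sub>R x + y) = r *\<^sub>R (c *\<^sub>C x) + c *\<^sub>C y"
      by (simp add: scaleC_add_right scaleC_scaleC mult.commute flip: scaleC_of_real)
    with step assms show ?case by (simp add: span_add span_scale span_base)
  qed
  then have "complex_vector.subspace (span S)"
    by (intro complex_vector.subspaceI) (auto simp: span_zero span_add)
  then show "cspan S \<subseteq> span S"
    by (intro complex_vector.span_minimal) (auto simp: span_base)
  have "subspace (cspan S)"
    by (intro subspaceI)
      (auto simp: complex_vector.span_zero complex_vector.span_add complex_vector.span_scale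
        simp flip: scaleC_of_real)
  then show "span S \<subseteq> cspan S"
    by (intro span_minimal) (auto simp: complex_vector.span_base)
qed

lemma op_powi_scaleC:
  assumes "unitary U"
  shows "op_powi U t (c *\<^sub>C x) = c *\<^sub>C op_powi U t x"
  unfolding op_powi_def unitaryD(4)[OF assms]
  using bounded_clinearD(2)[OF bounded_clinear_funpow[OF unitaryD(1)[OF assms]]]
    bounded_clinearD(2)[OF bounded_clinear_funpow[OF bounded_clinear_cadjoint[OF unitaryD(1)[OF assms]]]]
  by simp

lemma minimal_unitary_dilation_single:
  assumes "minimal_unitary_dilation J [S] [U]"
  shows "unitary_dilation J [S] [U]"
    and "closure (span (range (\<lambda>(t, h). op_powi U t (J h)))) = UNIV"
proof -
  show dil: "unitary_dilation J [S] [U]"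
    using assms by (simp add: minimal_unitary_dilation_def)
  then have U: "unitary U" and J: "bounded_clinear J"
    by (auto simp: unitary_dilation_single_iff isometric_embedding_iff)
  have "{op_prod (map2 op_powi [U] ts) (J h) | h ts. length ts = length [U]}
      = range (\<lambda>(t, h). op_powi U t (J h))"
  proof (intro equalityI subsetI)
    fix x assume "x \<in> range (\<lambda>(t, h). op_powi U t (J h))"
    then obtain t h where "x = op_powi U t (J h)" by auto
    then show "x \<in> {op_prod (map2 op_powi [U] ts) (J h) | h ts. length ts = length [U]}"
      by (intro CollectI exI[of _ h] exI[of _ "[t]"]) (simp add: op_prod_simps)
  next
    fix x assume "x \<in> {op_prod (map2 op_powi [U] ts) (J h) | h ts. length ts = length [U]}"
    then obtain t h where "x = op_powi U t (J h)"
      by (auto simp: op_prod_simps length_Suc_conv)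
    then show "x \<in> range (\<lambda>(t, h). op_powi U t (J h))"
      by (intro range_eqI[of _ _ "(t, h)"]) simp
  qed
  moreover have "cspan (range (\<lambda>(t, h). op_powi U t (J h))) = span (range (\<lambda>(t, h). op_powi U t (J h)))"
  proof (rule cspan_eq_span)
    fix c x assume "x \<in> range (\<lambda>(t, h). op_powi U t (J h))"
    then obtain t h where "x = op_powi U t (J h)" by auto
    then show "c *\<^sub>C x \<in> range (\<lambda>(t, h). op_powi U t (J h))"
      by (intro range_eqI[of _ _ "(t, c *\<^sub>C h)"])
        (simp add: op_powi_scaleC[OF U] bounded_clinearD(2)[OF J])
  qed
  ultimately show "closure (span (range (\<lambda>(t, h). op_powi U t (J h)))) = UNIV"
    using assms by (simp only: minimal_unitary_dilation_def)
qed

text \<open>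
  The Gram matrix of the orbit depends on \<open>S\<close> alone, which is why the minimal dilation is unique.
  The entries with \<open>s > t\<close> follow by symmetry of \<open>\<bullet>\<close>.
\<close>

lemma inner_orbit:
  assumes dil: "unitary_dilation J [S] [U]" and "s \<le> t"
  shows "op_powi U s (J h) \<bullet> op_powi U t (J g) = h \<bullet> (S ^^ nat (t - s)) g"
proof -
  have U: "unitary U" and comp: "\<And>n h g. (S ^^ n) h \<bullet> g = (U ^^ n) (J h) \<bullet> J g"
    using dil by (auto simp: unitary_dilation_single_iff)
  \<comment> \<open>\<open>U ^^ n\<close> preserves inner products and makes both exponents nonnegative\<close>
  define n where "n = nat \<bar>s\<bar>"
  define a where "a = nat (int n + s)"
  define m where "m = nat (t - s)"
  have shift: "int n + s = int a" "int n + t = int (a + m)"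
    using \<open>s \<le> t\<close> by (auto simp: n_def a_def m_def)
  have "op_powi U s (J h) \<bullet> op_powi U t (J g)
      = (U ^^ n) (op_powi U s (J h)) \<bullet> (U ^^ n) (op_powi U t (J g))"
    by (simp add: inner_unitary_funpow[OF U])
  also have "\<dots> = (U ^^ a) (J h) \<bullet> (U ^^ (a + m)) (J g)"
    unfolding funpow_op_powi[OF unitaryD(3)[OF U]] shift by (simp only: op_powi_def nat_int) simp
  also have "\<dots> = J h \<bullet> (U ^^ m) (J g)"
    by (simp add: funpow_add inner_unitary_funpow[OF U])
  also have "\<dots> = h \<bullet> (S ^^ m) g"
    using comp[of m g h] by (simp add: inner_commute)
  finally show ?thesis by (simp add: m_def)
qed

text \<open>
  The isometry \<open>\<Phi>\<close> that matches the two orbits is first obtained as a real linear map. Complex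
  linearity and \<open>\<Phi> \<circ> U = V \<circ> \<Phi>\<close> are identities between bounded linear maps, so it is
  enough to check them on the orbit; there they hold because scalars and \<open>U\<close>, \<open>V\<close> only change
  the index \<open>(t, h)\<close>, to \<open>(t, c *\<^sub>C h)\<close> and \<open>(t + 1, h)\<close>.
\<close>

lemma minimal_unitary_dilation_unique:
  fixes J :: "'h::complex_hilbert \<Rightarrow> 'k::complex_hilbert" and J' :: "'h \<Rightarrow> 'l::complex_hilbert"
  assumes U: "minimal_unitary_dilation J [S] [U]" and V: "minimal_unitary_dilation J' [S] [V]"
  obtains \<Phi> where "isometric_embedding \<Phi>" "surj \<Phi>" "\<Phi> \<circ> J = J'" "\<Phi> \<circ> U = V \<circ> \<Phi>"
proof -
  note dil = minimal_unitary_dilation_single(1)[OF U] minimal_unitary_dilation_single(1)[OF V]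
  note dense = minimal_unitary_dilation_single(2)[OF U] minimal_unitary_dilation_single(2)[OF V]
  define f where "f = (\<lambda>(t, h). op_powi U t (J h))"
  define g where "g = (\<lambda>(t, h). op_powi V t (J' h))"
  have unitary: "unitary U" "unitary V" and bounded: "bounded_clinear J" "bounded_clinear J'"
    using dil by (auto simp: unitary_dilation_single_iff isometric_embedding_iff)
  have "f (s, h) \<bullet> f (t, h') = g (s, h) \<bullet> g (t, h')" for s t h h'
  proof (cases "s \<le> t")
    case True
    then show ?thesis by (simp add: f_def g_def inner_orbit[OF dil(1)] inner_orbit[OF dil(2)])
  next
    case False
    then show ?thesis
      using inner_orbit[OF dil(1), of t s h' h] inner_orbit[OF dil(2), of t s h' h]
      by (simp add: f_def g_def inner_commute)
  qed
  then have "f i \<bullet> f j = g i \<bullet> g j" for i j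
    by (cases i; cases j) simp
  then obtain \<Phi> where \<Phi>: "bounded_linear \<Phi>" "\<And>x y. \<Phi> x \<bullet> \<Phi> y = x \<bullet> y" "surj \<Phi>" "\<And>i. \<Phi> (f i) = g i"
    using isometry_of_dense_families[of f g] dense unfolding f_def g_def by metis
  have orbit: "\<Phi> (op_powi U t (J h)) = op_powi V t (J' h)" for t h
    using \<Phi>(4)[of "(t, h)"] by (simp add: f_def g_def)
  have ext: "a x = b x"
    if "bounded_linear a" "bounded_linear b" "\<And>t h. a (op_powi U t (J h)) = b (op_powi U t (J h))"
    for a b :: "'k \<Rightarrow> 'l" and x
  proof (rule bounded_linear_eq_on_closure_span[OF that(1,2), of "range f"])
    show "a y = b y" if "y \<in> range f" for y
      using that \<open>\<And>t h. a (op_powi U t (J h)) = b (op_powi U t (J h))\<close> by (auto simp: f_def)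
    show "x \<in> closure (span (range f))" using dense(1) by (simp add: f_def)
  qed
  have "\<Phi> (c *\<^sub>C x) = c *\<^sub>C \<Phi> x" for c x
  proof (rule ext)
    show "\<Phi> (c *\<^sub>C op_powi U t (J h)) = c *\<^sub>C \<Phi> (op_powi U t (J h))" for t h
      by (simp add: orbit op_powi_scaleC[symmetric] unitary bounded_clinearD(2)[symmetric] bounded)
  qed (intro bounded_linear_compose[OF \<Phi>(1)] bounded_linear_compose[OF _ \<Phi>(1)] bounded_linear_scaleC)+
  then have "isometric_embedding \<Phi>"
    using \<Phi>(1,2) by (simp add: isometric_embedding_iff bounded_clinear_def)
  moreover have "\<Phi> \<circ> J = J'"
    using orbit[of 0] by (simp add: op_powi_def fun_eq_iff)
  moreover have "\<Phi> (U x) = V (\<Phi> x)" for x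
  proof (rule ext)
    show "\<Phi> (U (op_powi U t (J h))) = V (\<Phi> (op_powi U t (J h)))" for t h
      by (simp add: orbit op_powi_Suc unitaryD(3) unitary)
  qed (intro bounded_linear_compose[OF \<Phi>(1)] bounded_linear_compose[OF _ \<Phi>(1)]
      bounded_clinearD(1) unitaryD(1) unitary)+
  ultimately show thesis
    using that \<Phi>(3) by (simp add: fun_eq_iff)
qed

section \<open>Transport of dilations\<close>

lemma op_prod_conjugate:
  assumes "isometric_embedding \<Phi>" "surj \<Phi>"
  shows "op_prod (map (\<lambda>A. \<Phi> \<circ> A \<circ> cadjoint \<Phi>) As) = \<Phi> \<circ> op_prod As \<circ> cadjoint \<Phi>"
  by (induction As)
    (simp_all add: op_prod_simps fun_eq_iff cadjoint_isometry cadjoint_surj_isometry assms)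

lemma funpow_conjugate:
  assumes "isometric_embedding \<Phi>" "surj \<Phi>"
  shows "(\<Phi> \<circ> A \<circ> cadjoint \<Phi>) ^^ n = \<Phi> \<circ> A ^^ n \<circ> cadjoint \<Phi>"
  by (induction n)
    (simp_all add: fun_eq_iff cadjoint_isometry cadjoint_surj_isometry assms)

lemma unitary_dilation_transport:
  assumes dil: "unitary_dilation J Ts Ws" and \<Phi>: "isometric_embedding \<Phi>" "surj \<Phi>"
  shows "unitary_dilation (\<Phi> \<circ> J) Ts (map (\<lambda>W. \<Phi> \<circ> W \<circ> cadjoint \<Phi>) Ws)"
proof -
  note dil = dil[unfolded unitary_dilation_iff]
  have bounded: "bounded_clinear \<Phi>" and isometry: "\<Phi> x \<bullet> \<Phi> y = x \<bullet> y" for x y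
    using \<Phi>(1) by (auto simp: isometric_embedding_iff)
  note inverse = cadjoint_isometry[OF \<Phi>(1)] cadjoint_surj_isometry[OF \<Phi>]
  have isometry': "cadjoint \<Phi> x \<bullet> cadjoint \<Phi> y = x \<bullet> y" for x y
    by (metis inverse(2) isometry)
  have surj': "surj (cadjoint \<Phi>)" by (rule surjI) (rule inverse(1))
  show ?thesis
    unfolding unitary_dilation_iff
  proof (intro conjI allI impI ballI)
    show "isometric_embedding (\<Phi> \<circ> J)"
      using dil bounded isometry by (auto simp: isometric_embedding_iff intro: bounded_clinear_comp)
    show "length (map (\<lambda>W. \<Phi> \<circ> W \<circ> cadjoint \<Phi>) Ws) = length Ts"
      using dil by simp
    have "W (W' x) = W' (W x)" if "W \<in> set Ws" "W' \<in> set Ws" for W W' x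
      using dil that unfolding commuting_def by (metis comp_apply)
    then show "commuting (map (\<lambda>W. \<Phi> \<circ> W \<circ> cadjoint \<Phi>) Ws)"
      unfolding commuting_def by (auto simp: fun_eq_iff inverse)
    fix Z assume "Z \<in> set (map (\<lambda>W. \<Phi> \<circ> W \<circ> cadjoint \<Phi>) Ws)"
    then obtain W where Z: "Z = \<Phi> \<circ> W \<circ> cadjoint \<Phi>" and "unitary W"
      using dil by auto
    then show "unitary Z"
      using bounded bounded_clinear_cadjoint[OF bounded] \<Phi>(2) surj' isometry isometry'
      unfolding unitary_iff isometric_embedding_iff Z
      by (intro conjI bounded_clinear_comp comp_surj) auto
  next
    fix ks :: "nat list" and h g
    assume "length ks = length Ts"
    moreover have "map2 (\<lambda>A k. A ^^ k) (map (\<lambda>W. \<Phi> \<circ> W \<circ> cadjoint \<Phi>) Ws) ks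
        = map (\<lambda>A. \<Phi> \<circ> A \<circ> cadjoint \<Phi>) (map2 (\<lambda>A k. A ^^ k) Ws ks)"
      by (simp add: zip_map1 funpow_conjugate[OF \<Phi>] case_prod_unfold)
    then have "op_prod (map2 (\<lambda>A k. A ^^ k) (map (\<lambda>W. \<Phi> \<circ> W \<circ> cadjoint \<Phi>) Ws) ks)
        = \<Phi> \<circ> op_prod (map2 (\<lambda>A k. A ^^ k) Ws ks) \<circ> cadjoint \<Phi>"
      by (simp only: op_prod_conjugate[OF \<Phi>])
    ultimately show "op_prod (map2 (\<lambda>A k. A ^^ k) Ts ks) h \<bullet> g =
        op_prod (map2 (\<lambda>A k. A ^^ k) (map (\<lambda>W. \<Phi> \<circ> W \<circ> cadjoint \<Phi>) Ws) ks) ((\<Phi> \<circ> J) h) \<bullet> (\<Phi> \<circ> J) g"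
      using dil by (simp only: o_apply inverse isometry)
  qed
qed

section \<open>Dilations of the adjoint tuple\<close>

text \<open>
  The adjoints of the operators in \<open>Ws\<close>, conjugated by the unitary \<open>\<Phi>\<close> that intertwines the adjoint of their
  product with \<open>V\<close>, have product \<open>V\<close>.
\<close>

lemma dilation_of_adjoints:
  assumes Ts: "commuting Ts" "\<And>A. A \<in> set Ts \<Longrightarrow> bounded_clinear A"
    and V: "minimal_unitary_dilation J' [cadjoint (op_prod Ts)] [V]"
    and Ws: "unitary_dilation J Ts Ws" "minimal_unitary_dilation J [op_prod Ts] [op_prod Ws]"
  shows "\<exists>Zs. unitary_dilation J' (map cadjoint Ts) Zs \<and>
    minimal_unitary_dilation J' [cadjoint (op_prod Ts)] [op_prod Zs]"
proof -
  have Ws_bounded: "commuting Ws" "\<And>W. W \<in> set Ws \<Longrightarrow> bounded_clinear W"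
    using Ws(1) by (auto simp: unitary_dilation_def unitaryD(1))
  have "minimal_unitary_dilation J (map cadjoint [op_prod Ts]) (map cadjoint [op_prod Ws])"
    using bounded_clinear_op_prod[OF Ts(2)]
    by (intro minimal_unitary_dilation_cadjoint[OF Ws(2)]) (auto simp: commuting_def)
  then have "minimal_unitary_dilation J [cadjoint (op_prod Ts)] [op_prod (map cadjoint Ws)]"
    by (simp add: cadjoint_op_prod[OF Ws_bounded])
  then obtain \<Phi> where \<Phi>: "isometric_embedding \<Phi>" "surj \<Phi>" "\<Phi> \<circ> J = J'"
      "\<Phi> \<circ> op_prod (map cadjoint Ws) = V \<circ> \<Phi>"
    using minimal_unitary_dilation_unique[OF _ V] by metis
  define Zs where "Zs = map (\<lambda>W. \<Phi> \<circ> W \<circ> cadjoint \<Phi>) (map cadjoint Ws)"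
  have "unitary_dilation J' (map cadjoint Ts) Zs"
    unfolding Zs_def \<Phi>(3)[symmetric]
    by (intro unitary_dilation_transport unitary_dilation_cadjoint Ws(1) Ts \<Phi>(1,2))
  moreover have "op_prod Zs = V"
    unfolding Zs_def op_prod_conjugate[OF \<Phi>(1,2)] \<Phi>(4)
    by (simp add: fun_eq_iff cadjoint_surj_isometry[OF \<Phi>(1,2)])
  ultimately show ?thesis using V by blast
qed

theorem theorem3p10:
  fixes Ts :: "('h::complex_hilbert \<Rightarrow> 'h) list"
    and T :: "'h \<Rightarrow> 'h"
    and J :: "'h \<Rightarrow> 'k::complex_hilbert" and U :: "'k \<Rightarrow> 'k"
    and J' :: "'h \<Rightarrow> 'l::complex_hilbert" and V :: "'l \<Rightarrow> 'l"
  assumes "Ts \<noteq> []"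
    and "commuting Ts"
    and "\<forall>A\<in>set Ts. contraction A"
    and "T = op_prod Ts"
    and "minimal_unitary_dilation J [T] [U]"
    and "minimal_unitary_dilation J' [cadjoint T] [V]"
  shows "(\<exists>Ws. unitary_dilation J Ts Ws \<and>
               minimal_unitary_dilation J [T] [op_prod Ws]) \<longleftrightarrow>
         (\<exists>Zs. unitary_dilation J' (map cadjoint Ts) Zs \<and>
               minimal_unitary_dilation J' [cadjoint T] [op_prod Zs])"
proof -
  have bounded: "bounded_clinear A" if "A \<in> set Ts" for A
    using assms(3) that by (simp add: contraction_def)
  have bounded': "bounded_clinear A" if "A \<in> set (map cadjoint Ts)" for A
    using that by (auto intro: bounded_clinear_cadjoint bounded)
  have T: "bounded_clinear T"
    unfolding assms(4) by (rule bounded_clinear_op_prod[OF bounded])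
  have adjoint: "op_prod (map cadjoint Ts) = cadjoint T"
    unfolding assms(4) by (rule cadjoint_op_prod[OF assms(2) bounded, symmetric])
  have adjoint_adjoint: "map cadjoint (map cadjoint Ts) = Ts"
    by (simp add: map_idI cadjoint_cadjoint bounded)
  show ?thesis
  proof
    assume "\<exists>Ws. unitary_dilation J Ts Ws \<and> minimal_unitary_dilation J [T] [op_prod Ws]"
    then show "\<exists>Zs. unitary_dilation J' (map cadjoint Ts) Zs \<and>
        minimal_unitary_dilation J' [cadjoint T] [op_prod Zs]"
      using dilation_of_adjoints[OF assms(2) bounded] assms(4,6) by blast
  next
    assume "\<exists>Zs. unitary_dilation J' (map cadjoint Ts) Zs \<and>
        minimal_unitary_dilation J' [cadjoint T] [op_prod Zs]"
    then show "\<exists>Ws. unitary_dilation J Ts Ws \<and> minimal_unitary_dilation J [T] [op_prod Ws]"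
      using dilation_of_adjoints[OF commuting_map_cadjoint[OF assms(2) bounded] bounded', of J U J']
        assms(5)
      unfolding adjoint adjoint_adjoint cadjoint_cadjoint[OF T] by blast
  qed
qed

end
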